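(* Let $\mathfrak a:[-1,1]\times\mathbb R_+\to\mathbb R_+$ be a continuous function. Suppose that the inequality $I(\mathfrak a,\overline u)\le I(\mathfrak a,u)$ holds for all $F\in\mathfrak F$ and all non-negative piecewise linear functions $u$ on $[-1,1]$ with $u(-1)=u(1)=0$. Then for all $s,t\in[-1,1]$ and all $v\in\mathbb R_+$ $$\mathfrak a(s,v)+\mathfrak a(t,v)\ge\mathfrak a\Big(\frac{s-t}2,v\Big)+\mathfrak a\Big(\frac{t-s}2,v\Big).$$
   Context: $\mathbb R_+=[0,\infty)$. $\mathfrak F$ is the set of continuous functions $F:\mathbb R_+\times\mathbb R_+\to\mathbb R_+$ that are convex and strictly increasing with respect to the second argument. Piecewise linear functions are continuous with finitely many linear pieces. For $F\in\mathfrak F$, a continuous weight $\mathfrak a:[-1,1]\times\mathbb R_+\to\mathbb R_+$ and a non-negative $u\in W_1^1(-1,1)$ (absolutely continuous functions on $[-1,1]$), $$I(\mathfrak a,u)=\int_{-1}^1 F\big(u(x),\mathfrak a(x,u(x))\,|u'(x)|\big)\,dx\in[0,\infty].$$ The symmetric rearrangement of a measurable set $E\subset[-1,1]$ is $\overline E=[-\tfrac{|E|}2,\tfrac{|E|}2]$, with $|E|$ the Lebesgue measure and $\overline\emptyset=\emptyset$. For non-negative $u$, with $\mathcal A_t=\{x\in[-1,1]:u(x)>t\}$, the symmetric rearrangement of $u$ is $\overline u(x)=\int_0^\infty\chi_{\overline{\mathcal A_t}}(x)\,dt$. *)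

theory Defs
  imports "HOL-Analysis.Analysis"
begin

definition integrand_class :: "(real \<Rightarrow> real \<Rightarrow> real) set"  ("\<FF>") where
  "\<FF> = {F. continuous_on ({0..} \<times> {0..}) (\<lambda>(v, p). F v p) \<and>
          (\<forall>v\<ge>0. \<forall>p\<ge>0. F v p \<ge> 0) \<and>
          (\<forall>v\<ge>0. convex_on {0..} (F v) \<and> strict_mono_on {0..} (F v))}"

text \<open>"Linear" pieces are affine, as usual for piecewise linear functions.\<close>
definition piecewise_linear_on :: "real \<Rightarrow> real \<Rightarrow> (real \<Rightarrow> real) \<Rightarrow> bool" where
  "piecewise_linear_on a b u \<longleftrightarrow> continuous_on {a..b} u \<and>
     (\<exists>(n::nat) p. p 0 = a \<and> p n = b \<and>
        (\<forall>i<n. p i < p (Suc i) \<and>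
           (\<exists>c d. \<forall>x\<in>{p i<..<p (Suc i)}. u x = c * x + d)))"

text \<open>
  For absolutely continuous u on [-1,1] the classical derivative exists almost everywhere and
  is the weak derivative; the arbitrary values of \<open>deriv\<close> on the remaining null set (which
  includes the endpoints) do not affect the integral. The value is in [0,\<infinity>].
\<close>
definition weighted_functional ::
  "(real \<Rightarrow> real \<Rightarrow> real) \<Rightarrow> (real \<Rightarrow> real \<Rightarrow> real) \<Rightarrow> (real \<Rightarrow> real) \<Rightarrow> ennreal" where
  "weighted_functional F \<aa> u =
     (\<integral>\<^sup>+x\<in>{-1..1}. ennreal (F (u x) (\<aa> x (u x) * \<bar>deriv u x\<bar>)) \<partial>lebesgue)"

definition symm_rearr_set :: "real set \<Rightarrow> real set" where
  "symm_rearr_set E =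
     (if E = {} then {} else {- (measure lebesgue E / 2)..measure lebesgue E / 2})"

definition superlevel :: "(real \<Rightarrow> real) \<Rightarrow> real \<Rightarrow> real set" where
  "superlevel u t = {x\<in>{-1..1}. u x > t}"

text \<open>
  For u bounded above on [-1,1], in particular for continuous u, the integrand vanishes for
  large t, so the Bochner integral is the genuine finite value.
\<close>
definition symm_rearr :: "(real \<Rightarrow> real) \<Rightarrow> real \<Rightarrow> real" where
  "symm_rearr u x = (LINT t:{0..}|lebesgue. indicator (symm_rearr_set (superlevel u t)) x)"

end

theory Submission
  imports Defs
begin

text \<open>
  For an integrand \<open>F v p = \<phi> v * p\<close> that is linear in the slope, the functional does not see
  how steep \<open>u\<close> is: on each monotone branch of \<open>u\<close>, substituting the level \<open>w = u x\<close> turns it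
  into the integral of \<open>\<phi> w * \<aa> (x w) w\<close> over the levels, where \<open>x w\<close> is the point of the
  branch at level \<open>w\<close>, and a horizontal piece contributes nothing. So for a function with one
  increasing and one decreasing branch the functional is a \<open>\<phi>\<close>-weighted integral of the sum
  of \<open>\<aa>\<close> over the two end points of the superlevel intervals.

  Let \<open>u\<close> be the trapezoid that rises from \<open>-1\<close> to height \<open>V\<close> at \<open>s\<close>, is constant up to \<open>t\<close>
  and falls to \<open>0\<close> at \<open>1\<close>. Its rearrangement centres every superlevel interval at the origin, so
  it is the trapezoid with \<open>\<plusminus>(t - s) / 2\<close> in place of \<open>s\<close> and \<open>t\<close>
  (\<open>symm_rearr_trapezoid\<close>). With the substitution formula (\<open>weighted_functional_trapezoid\<close>),
  the hypothesis implies that the difference \<open>G w\<close> of the two end point sums has a nonnegative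
  integral over \<open>[0, V]\<close> against every positive continuous \<open>\<phi>\<close>. Hence \<open>G \<ge> 0\<close>
  (\<open>continuous_nonneg_if_weighted_integrals_nonneg\<close>). At the top level \<open>w = V\<close> the end points
  are \<open>s\<close>, \<open>t\<close> and \<open>\<plusminus>(t - s) / 2\<close>, and \<open>G V \<ge> 0\<close> is the claim for \<open>v = V > 0\<close> and
  \<open>-1 < s < t < 1\<close>. The remaining cases follow from continuity of \<open>\<aa>\<close> and from the symmetry
  of the claim in \<open>s\<close> and \<open>t\<close>.
\<close>

section \<open>Trapezoids\<close>

text \<open>
  The minimum of the constant \<open>V\<close> and the two lines that carry the legs: superlevel sets of a
  minimum are intersections, which makes them easy to compute.
\<close>
definition trapezoid :: "real \<Rightarrow> real \<Rightarrow> real \<Rightarrow> real \<Rightarrow> real" where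
  "trapezoid s t V x = min V (min (V * (x + 1) / (s + 1)) (V * (1 - x) / (1 - t)))"

text \<open>The inverses of the two legs: the abscissa at which a leg reaches the level \<open>w\<close>.\<close>
definition left_leg :: "real \<Rightarrow> real \<Rightarrow> real \<Rightarrow> real" where
  "left_leg s V w = -1 + (s + 1) * w / V"

definition right_leg :: "real \<Rightarrow> real \<Rightarrow> real \<Rightarrow> real" where
  "right_leg t V w = 1 - (1 - t) * w / V"

lemma left_leg_mem:
  assumes "-1 \<le> s" "s \<le> 1" "0 < V" "w \<in> {0..V}"
  shows "left_leg s V w \<in> {-1..1}"
proof -
  have "(s + 1) * (w / V) \<le> 2 * 1" "0 \<le> (s + 1) * (w / V)"
    using assms by (intro mult_mono mult_nonneg_nonneg; simp)+
  then show ?thesis by (simp add: left_leg_def)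
qed

lemma right_leg_mem:
  assumes "-1 \<le> t" "t \<le> 1" "0 < V" "w \<in> {0..V}"
  shows "right_leg t V w \<in> {-1..1}"
proof -
  have "(1 - t) * (w / V) \<le> 2 * 1" "0 \<le> (1 - t) * (w / V)"
    using assms by (intro mult_mono mult_nonneg_nonneg; simp)+
  then show ?thesis by (simp add: right_leg_def)
qed

lemma continuous_on_trapezoid: "continuous_on A (trapezoid s t V)"
  unfolding trapezoid_def divide_inverse by (intro continuous_intros)

lemma trapezoid_nonneg:
  assumes "-1 < s" "t < 1" "0 < V" "x \<in> {-1..1}"
  shows "0 \<le> trapezoid s t V x"
  using assms by (auto simp: trapezoid_def)

lemma trapezoid_left:
  assumes "-1 < s" "s < t" "t < 1" "0 < V" "x \<le> s"
  shows "trapezoid s t V x = V * (x + 1) / (s + 1)"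
proof -
  have "(x + 1) / (s + 1) \<le> 1" "1 \<le> (1 - x) / (1 - t)"
    using assms by auto
  from this[THEN mult_left_mono, of V] show ?thesis
    using assms by (simp add: trapezoid_def)
qed

lemma trapezoid_right:
  assumes "-1 < s" "s < t" "t < 1" "0 < V" "t \<le> x"
  shows "trapezoid s t V x = V * (1 - x) / (1 - t)"
proof -
  have "1 \<le> (x + 1) / (s + 1)" "(1 - x) / (1 - t) \<le> 1"
    using assms by auto
  from this[THEN mult_left_mono, of V] show ?thesis
    using assms by (simp add: trapezoid_def)
qed

lemma trapezoid_middle:
  assumes "-1 < s" "s < t" "t < 1" "0 < V" "s \<le> x" "x \<le> t"
  shows "trapezoid s t V x = V"
proof -
  have "1 \<le> (x + 1) / (s + 1)" "1 \<le> (1 - x) / (1 - t)"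
    using assms by auto
  from this[THEN mult_left_mono, of V] show ?thesis
    using assms by (simp add: trapezoid_def)
qed

lemma piecewise_linear_on_trapezoid:
  assumes "-1 < s" "s < t" "t < 1" "0 < V"
  shows "piecewise_linear_on (-1) 1 (trapezoid s t V)"
  unfolding piecewise_linear_on_def
proof (intro conjI exI)
  define p where "p = (\<lambda>i::nat. if i = 0 then -1 else if i = 1 then s else if i = 2 then t else (1::real))"
  show "continuous_on {-1..1} (trapezoid s t V)" by (rule continuous_on_trapezoid)
  show "p 0 = -1" "p 3 = 1" by (simp_all add: p_def)
  have l: "\<exists>c d. \<forall>x\<in>{-1<..<s}. trapezoid s t V x = c * x + d"
  proof (intro exI ballI)
    fix x assume "x \<in> {-1<..<s}"
    then show "trapezoid s t V x = V / (s + 1) * x + V / (s + 1)"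
      using assms by (simp add: trapezoid_left distrib_left add_divide_distrib)
  qed
  have m: "\<exists>c d. \<forall>x\<in>{s<..<t}. trapezoid s t V x = c * x + d"
  proof (intro exI ballI)
    fix x assume "x \<in> {s<..<t}"
    then show "trapezoid s t V x = 0 * x + V"
      using assms by (simp add: trapezoid_middle)
  qed
  have r: "\<exists>c d. \<forall>x\<in>{t<..<1}. trapezoid s t V x = c * x + d"
  proof (intro exI ballI)
    fix x assume "x \<in> {t<..<1}"
    then show "trapezoid s t V x = - V / (1 - t) * x + V / (1 - t)"
      using assms by (simp add: trapezoid_right diff_divide_distrib right_diff_distrib)
  qed
  show "\<forall>i<3. p i < p (Suc i) \<and>
      (\<exists>c d. \<forall>x\<in>{p i<..<p (Suc i)}. trapezoid s t V x = c * x + d)"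
  proof (intro allI impI)
    fix i :: nat assume "i < 3"
    then consider "i = 0" | "i = 1" | "i = 2" by linarith
    then show "p i < p (Suc i) \<and>
      (\<exists>c d. \<forall>x\<in>{p i<..<p (Suc i)}. trapezoid s t V x = c * x + d)"
      using l m r assms by cases (simp_all add: p_def)
  qed
qed

section \<open>The symmetric rearrangement of a trapezoid\<close>

lemma superlevel_trapezoid:
  assumes "-1 < s" "s < t" "t < 1" "0 \<le> \<tau>" "\<tau> < V"
  shows "superlevel (trapezoid s t V) \<tau> = {left_leg s V \<tau> <..< right_leg t V \<tau>}"
proof -
  have V: "V > 0" using assms by linarith
  have "\<tau> < V * (x + 1) / (s + 1) \<longleftrightarrow> left_leg s V \<tau> < x" for x
    using assms V by (simp add: left_leg_def field_simps)
  moreover have "\<tau> < V * (1 - x) / (1 - t) \<longleftrightarrow> x < right_leg t V \<tau>" for x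
    using assms V by (simp add: right_leg_def field_simps)
  ultimately have "\<tau> < trapezoid s t V x \<longleftrightarrow> left_leg s V \<tau> < x \<and> x < right_leg t V \<tau>" for x
    using assms by (simp add: trapezoid_def)
  moreover have "-1 \<le> left_leg s V \<tau>" "right_leg t V \<tau> \<le> 1"
    using left_leg_mem[of s V \<tau>] right_leg_mem[of t V \<tau>] assms V by simp_all
  ultimately show ?thesis
    unfolding superlevel_def set_eq_iff mem_Collect_eq atLeastAtMost_iff greaterThanLessThan_iff
    by (meson less_imp_le order.strict_trans1 order.strict_trans2)
qed

text \<open>
  The superlevel interval at level \<open>\<tau> < V\<close> has half length \<open>1 - (1 - r) \<tau> / V\<close> with
  \<open>r = (t - s) / 2\<close>, which is affine in \<open>\<tau>\<close>. The levels whose centred interval contains \<open>x\<close>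
  thus form an interval starting at \<open>0\<close>, and its length is the value of the rearrangement at
  \<open>x\<close>.
\<close>
lemma symm_rearr_trapezoid:
  assumes st: "-1 < s" "s < t" "t < 1" and V: "0 < V" and x: "x \<in> {-1..1}"
  shows "symm_rearr (trapezoid s t V) x = trapezoid (- ((t - s) / 2)) ((t - s) / 2) V x"
proof -
  define r where "r = (t - s) / 2"
  define c where "c = V * (1 - \<bar>x\<bar>) / (1 - r)"
  have r: "0 < r" "r < 1" using st by (auto simp: r_def)
  have c0: "0 \<le> c" using x r V by (auto simp: c_def)
  have mem: "x \<in> symm_rearr_set (superlevel (trapezoid s t V) \<tau>) \<longleftrightarrow> \<tau> < V \<and> \<tau> \<le> c"
    if "0 \<le> \<tau>" for \<tau>
  proof (cases "\<tau> < V")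
    case True
    define l where "l = 1 - (1 - r) * \<tau> / V"
    have "(1 - r) * (\<tau> / V) < 1 * 1"
      using r True V that by (intro mult_strict_mono) auto
    then have l0: "0 < l" by (simp add: l_def)
    have len: "right_leg t V \<tau> - left_leg s V \<tau> = 2 * l"
      using V by (simp add: left_leg_def right_leg_def l_def r_def field_simps)
    then have ne: "{left_leg s V \<tau> <..< right_leg t V \<tau>} \<noteq> {}"
      using l0 by auto
    have "measure lebesgue {left_leg s V \<tau> <..< right_leg t V \<tau>} = 2 * l"
      using len l0 by (subst measure_lborel_Ioo[THEN trans[rotated]]) auto
    then have "symm_rearr_set (superlevel (trapezoid s t V) \<tau>) = {-l..l}"
      using ne by (simp add: superlevel_trapezoid[OF st that True] symm_rearr_set_def)
    moreover have "x \<in> {-l..l} \<longleftrightarrow> \<bar>x\<bar> \<le> l" by auto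
    moreover have "\<bar>x\<bar> \<le> l \<longleftrightarrow> \<tau> \<le> c"
      using r V by (simp add: l_def c_def field_simps)
    ultimately show ?thesis using True by simp
  next
    case False
    then have "superlevel (trapezoid s t V) \<tau> = {}"
      by (auto simp: superlevel_def trapezoid_def)
    then show ?thesis using False by (simp add: symm_rearr_set_def)
  qed
  \<comment> \<open>For \<open>c \<ge> V\<close> the interval is half-open because the superlevel set at the level \<open>V\<close> itself
     is empty.\<close>
  define K where "K = {\<tau>. 0 \<le> \<tau> \<and> \<tau> < V \<and> \<tau> \<le> c}"
  have K: "K = (if c < V then {0..c} else {0..<V})"
    by (auto simp: K_def)
  have "symm_rearr (trapezoid s t V) x = (LINT \<tau>|lebesgue. indicator K \<tau>)"
    unfolding symm_rearr_def set_lebesgue_integral_def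
    by (rule Bochner_Integration.integral_cong) (auto simp: mem K_def indicator_def)
  also have "\<dots> = min V c"
    using c0 V by (simp add: K)
  also have "\<dots> = trapezoid (- r) r V x"
  proof -
    have "c = min (V * (x + 1) / (1 - r)) (V * (1 - x) / (1 - r))"
    proof -
      have "c \<le> V * (x + 1) / (1 - r)" "c \<le> V * (1 - x) / (1 - r)"
        unfolding c_def using r V by (intro divide_right_mono mult_left_mono; simp)+
      moreover have "c = V * (x + 1) / (1 - r) \<or> c = V * (1 - x) / (1 - r)"
        by (cases "0 \<le> x") (simp_all add: c_def add.commute)
      ultimately show ?thesis by linarith
    qed
    then show ?thesis by (simp add: trapezoid_def add.commute)
  qed
  finally show ?thesis by (simp add: r_def)
qed

section \<open>The functional as an integral over levels\<close>

lemma continuous_on_weight_compose: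
  fixes \<aa> :: "real \<Rightarrow> real \<Rightarrow> real"
  assumes "continuous_on ({-1..1} \<times> {0..}) (\<lambda>(x, v). \<aa> x v)"
    and "continuous_on A f" "continuous_on A g" "f ` A \<subseteq> {-1..1}" "g ` A \<subseteq> {0..}"
  shows "continuous_on A (\<lambda>z. \<aa> (f z) (g z))"
  using assms(2-) by (intro continuous_on_compose2[OF assms(1), of _ "\<lambda>z. (f z, g z)", simplified])
    (auto intro!: continuous_intros)

lemma continuous_on_weight_left_leg:
  fixes \<aa> :: "real \<Rightarrow> real \<Rightarrow> real"
  assumes "continuous_on ({-1..1} \<times> {0..}) (\<lambda>(x, v). \<aa> x v)"
    and "-1 \<le> s" "s \<le> 1" "0 < V"
  shows "continuous_on {0..V} (\<lambda>w. \<aa> (left_leg s V w) w)"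
proof (rule continuous_on_weight_compose[OF assms(1)])
  show "continuous_on {0..V} (left_leg s V)"
    unfolding left_leg_def using assms by (intro continuous_intros) auto
  show "left_leg s V ` {0..V} \<subseteq> {-1..1}"
    using left_leg_mem assms by blast
qed auto

lemma continuous_on_weight_right_leg:
  fixes \<aa> :: "real \<Rightarrow> real \<Rightarrow> real"
  assumes "continuous_on ({-1..1} \<times> {0..}) (\<lambda>(x, v). \<aa> x v)"
    and "-1 \<le> t" "t \<le> 1" "0 < V"
  shows "continuous_on {0..V} (\<lambda>w. \<aa> (right_leg t V w) w)"
proof (rule continuous_on_weight_compose[OF assms(1)])
  show "continuous_on {0..V} (right_leg t V)"
    unfolding right_leg_def using assms by (intro continuous_intros) auto
  show "right_leg t V ` {0..V} \<subseteq> {-1..1}"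
    using right_leg_mem assms by blast
qed auto

text \<open>
  The factor \<open>\<bar>u'\<bar>\<close> is the Jacobian of the substitution \<open>w = u x\<close> on each leg. The hypothesis
  requires only that \<open>u\<close> agrees with the trapezoid on \<open>[-1, 1]\<close>, since a rearrangement vanishes
  outside this interval whereas the formula for the trapezoid does not. The derivatives of the
  two can differ only at the end points.
\<close>
lemma weighted_functional_trapezoid:
  fixes \<aa> :: "real \<Rightarrow> real \<Rightarrow> real"
  assumes st: "-1 < s" "s < t" "t < 1" and V: "0 < V"
    and \<phi>: "continuous_on {0..} \<phi>" "\<And>w. 0 \<le> w \<Longrightarrow> 0 \<le> \<phi> w"
    and cont: "continuous_on ({-1..1} \<times> {0..}) (\<lambda>(x, v). \<aa> x v)"
    and nonneg: "\<forall>x\<in>{-1..1}. \<forall>v\<ge>0. \<aa> x v \<ge> 0"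
    and u: "\<And>x. x \<in> {-1..1} \<Longrightarrow> u x = trapezoid s t V x"
  shows "weighted_functional (\<lambda>w p. \<phi> w * p) \<aa> u =
    ennreal (integral {0..V} (\<lambda>w. \<phi> w *
      (\<aa> (left_leg s V w) w + \<aa> (right_leg t V w) w)))"
proof -
  define x1 where "x1 = left_leg s V"
  define x2 where "x2 = right_leg t V"
  define g1 where "g1 = (\<lambda>x. V * (x + 1) / (s + 1))"
  define g2 where "g2 = (\<lambda>x. V * (1 - x) / (1 - t))"
  define f where "f = (\<lambda>x. \<phi> (u x) * (\<aa> x (u x) * \<bar>deriv u x\<bar>))"
  have \<phi>V: "continuous_on {0..V} \<phi>"
    using \<phi>(1) by (rule continuous_on_subset) auto
  have c1: "continuous_on {0..V} (\<lambda>w. \<phi> w * \<aa> (x1 w) w)"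
    unfolding x1_def using st V
    by (intro continuous_on_mult[OF \<phi>V] continuous_on_weight_left_leg[OF cont]) simp_all
  have c2: "continuous_on {0..V} (\<lambda>w. \<phi> w * \<aa> (x2 w) w)"
    unfolding x2_def using st V
    by (intro continuous_on_mult[OF \<phi>V] continuous_on_weight_right_leg[OF cont]) simp_all
  have du: "deriv u x = D"
    if "(g has_field_derivative D) (at x)" "x \<in> S" "open S" "S \<subseteq> {-1..1}"
      "\<And>y. y \<in> S \<Longrightarrow> trapezoid s t V y = g y" for g D x S
  proof -
    have "(u has_field_derivative D) (at x)"
      using that(1,3,2) by (rule has_field_derivative_transform_within_open)
        (use that u in auto)
    then show ?thesis by (rule DERIV_imp_deriv)
  qed
  have d1: "(g1 has_field_derivative V / (s + 1)) (at x within A)" for x A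
    unfolding g1_def using st by (auto intro!: derivative_eq_intros)
  have x1g1: "x1 (g1 x) = x" for x
    using V st by (simp add: x1_def left_leg_def g1_def)
  have "g1 (-1) = 0" "g1 s = V" using st by (auto simp: g1_def)
  have "((\<lambda>x. (V / (s + 1)) *\<^sub>R (\<phi> (g1 x) * \<aa> (x1 (g1 x)) (g1 x))) has_integral
      integral {g1 (-1)..g1 s} (\<lambda>w. \<phi> w * \<aa> (x1 w) w)) {-1..s}"
  proof (rule has_integral_substitution[OF _ _ _ c1 d1])
    show "g1 ` {-1..s} \<subseteq> {0..V}"
      using st V by (auto simp: g1_def divide_le_eq)
  qed (use st V in \<open>auto simp: g1_def\<close>)
  then have "((\<lambda>x. V / (s + 1) * (\<phi> (g1 x) * \<aa> x (g1 x))) has_integral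
      integral {0..V} (\<lambda>w. \<phi> w * \<aa> (x1 w) w)) {-1..s}"
    by (simp add: x1g1 \<open>g1 (-1) = 0\<close> \<open>g1 s = V\<close>)
  then have i1: "(f has_integral integral {0..V} (\<lambda>w. \<phi> w * \<aa> (x1 w) w)) {-1..s}"
  proof (rule has_integral_spike_finite[rotated 2])
    fix x assume x: "x \<in> {-1..s} - {-1, s}"
    then have "deriv u x = V / (s + 1)"
      by (intro du[OF d1, of _ "{-1<..<s}"]) (use st V in \<open>auto simp: trapezoid_left g1_def\<close>)
    moreover have "u x = g1 x"
      using x st V by (simp add: u trapezoid_left g1_def)
    ultimately show "f x = V / (s + 1) * (\<phi> (g1 x) * \<aa> x (g1 x))"
      using st V by (simp add: f_def)
  qed simp
  \<comment> \<open>Where the trapezoid is horizontal, the slope and hence the integrand vanish.\<close>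
  have "((\<lambda>x. 0) has_integral 0) {s..t}" by simp
  then have i2: "(f has_integral 0) {s..t}"
  proof (rule has_integral_spike_finite[rotated 2])
    fix x assume x: "x \<in> {s..t} - {s, t}"
    then have "deriv u x = 0"
      by (intro du[OF DERIV_const, of _ "{s<..<t}" V]) (use st V in \<open>auto simp: trapezoid_middle\<close>)
    then show "f x = 0" by (simp add: f_def)
  qed simp
  \<comment> \<open>The right leg reverses orientation, and \<open>\<bar>u'\<bar> = - u'\<close> cancels the sign.\<close>
  have d2: "(g2 has_field_derivative - (V / (1 - t))) (at x within A)" for x A
    unfolding g2_def using st by (auto intro!: derivative_eq_intros)
  have x2g2: "x2 (g2 x) = x" for x
    using V st by (simp add: x2_def right_leg_def g2_def)
  have "((\<lambda>x. - (V / (1 - t)) *\<^sub>R (\<phi> (g2 x) * \<aa> (x2 (g2 x)) (g2 x))) has_integral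
      integral {g2 t..g2 1} (\<lambda>w. \<phi> w * \<aa> (x2 w) w)
      - integral {g2 1..g2 t} (\<lambda>w. \<phi> w * \<aa> (x2 w) w)) {t..1}"
  proof (rule has_integral_substitution_general[where s = "{}", OF _ _ _ c2 _ d2])
    show "g2 ` {t..1} \<subseteq> {0..V}"
      using st V by (auto simp: g2_def divide_le_eq)
    show "continuous_on {t..1} g2"
      using d2 by (rule DERIV_continuous_on)
  qed (use st V in auto)
  moreover have "g2 t = V" "g2 1 = 0" using st by (simp_all add: g2_def)
  ultimately have "((\<lambda>x. - (V / (1 - t) * (\<phi> (g2 x) * \<aa> x (g2 x)))) has_integral
      - integral {0..V} (\<lambda>w. \<phi> w * \<aa> (x2 w) w)) {t..1}"
    using V by (simp add: x2g2)
  then have "((\<lambda>x. V / (1 - t) * (\<phi> (g2 x) * \<aa> x (g2 x))) has_integral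
      integral {0..V} (\<lambda>w. \<phi> w * \<aa> (x2 w) w)) {t..1}"
    by (simp only: has_integral_neg_iff minus_minus)
  then have i3: "(f has_integral integral {0..V} (\<lambda>w. \<phi> w * \<aa> (x2 w) w)) {t..1}"
  proof (rule has_integral_spike_finite[rotated 2])
    fix x assume x: "x \<in> {t..1} - {t, 1}"
    then have "deriv u x = - (V / (1 - t))"
      by (intro du[OF d2, of _ "{t<..<1}"]) (use st V in \<open>auto simp: trapezoid_right g2_def\<close>)
    moreover have "u x = g2 x"
      using x st V by (simp add: u trapezoid_right g2_def)
    ultimately show "f x = V / (1 - t) * (\<phi> (g2 x) * \<aa> x (g2 x))"
      using st V by (simp add: f_def)
  qed simp
  have "(f has_integral integral {0..V} (\<lambda>w. \<phi> w * \<aa> (x1 w) w)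
      + 0 + integral {0..V} (\<lambda>w. \<phi> w * \<aa> (x2 w) w)) {-1..1}"
    by (rule has_integral_combine[OF _ _ has_integral_combine[OF _ _ i1 i2] i3]) (use st in auto)
  also have "integral {0..V} (\<lambda>w. \<phi> w * \<aa> (x1 w) w)
      + 0 + integral {0..V} (\<lambda>w. \<phi> w * \<aa> (x2 w) w)
    = integral {0..V} (\<lambda>w. \<phi> w * (\<aa> (x1 w) w + \<aa> (x2 w) w))" (is "_ = ?I")
    using integrable_continuous_interval[OF c1] integrable_continuous_interval[OF c2]
    by (simp add: integral_add[symmetric] distrib_left)
  finally have "(f has_integral ?I) {-1..1}" .
  moreover have "0 \<le> f x" if "x \<in> {-1..1}" for x
    using u[OF that] trapezoid_nonneg[of s t V x] that st V \<phi>(2) nonneg by (simp add: f_def)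
  ultimately have "(\<integral>\<^sup>+x. ennreal (f x) * indicator {-1..1} x \<partial>lborel) = ennreal ?I"
    by (intro nn_integral_has_integral_lebesgue')
  then have "weighted_functional (\<lambda>w p. \<phi> w * p) \<aa> u = ennreal ?I"
    by (simp add: weighted_functional_def nn_integral_completion f_def)
  then show ?thesis by (simp add: x1_def x2_def)
qed

section \<open>Testing against positive weights\<close>

text \<open>
  The negative part \<open>m = max 0 (- G)\<close> as a weight would give \<open>- \<integral> m\<^sup>2\<close>, which is
  negative if \<open>G\<close> is negative somewhere. It is not a strictly positive weight, but adding a small
  constant \<open>\<delta>\<close> makes it one and changes the integral only by \<open>\<delta> \<integral> G\<close>.
\<close>
lemma continuous_nonneg_if_weighted_integrals_nonneg:
  fixes G :: "real \<Rightarrow> real"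
  assumes V: "0 < V" and G: "continuous_on {0..V} G"
    and weighted: "\<And>\<phi>. continuous_on {0..} \<phi> \<Longrightarrow> (\<And>w. 0 \<le> w \<Longrightarrow> 0 < \<phi> w) \<Longrightarrow>
      0 \<le> integral {0..V} (\<lambda>w. \<phi> w * G w)"
    and w: "w \<in> {0..V}"
  shows "0 \<le> G w"
proof (rule ccontr)
  assume neg: "\<not> 0 \<le> G w"
  define m where "m = (\<lambda>w. max 0 (- G w))"
  define I where "I = integral {0..V} G"
  define J where "J = integral {0..V} (\<lambda>w. (m w)\<^sup>2)"
  have m: "continuous_on {0..V} m"
    unfolding m_def by (intro continuous_intros G)
  have m2: "continuous_on {0..V} (\<lambda>w. (m w)\<^sup>2)"
    by (intro continuous_intros m)
  have "J \<noteq> 0"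
    unfolding J_def using neg w V by (subst integral_eq_0_iff[OF m2]) (auto simp: m_def intro!: bexI[of _ w])
  moreover have "0 \<le> J"
    unfolding J_def by (rule integral_nonneg[OF integrable_continuous_interval[OF m2]]) simp
  ultimately have J: "0 < J" by simp
  \<comment> \<open>Evaluating \<open>m\<close> at \<open>min w V\<close> extends it continuously from \<open>[0, V]\<close> to the half line.\<close>
  have ineq: "0 \<le> \<delta> * I - J" if "0 < \<delta>" for \<delta>
  proof -
    have "continuous_on {0..} (\<lambda>w. m (min w V))"
      by (rule continuous_on_compose2[OF m]) (use V in \<open>auto intro!: continuous_intros\<close>)
    then have "0 \<le> integral {0..V} (\<lambda>w. (\<delta> + m (min w V)) * G w)"
      using that by (intro weighted) (auto intro!: continuous_intros simp: m_def)
    also have "\<dots> = integral {0..V} (\<lambda>w. \<delta> * G w - (m w)\<^sup>2)"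
      by (rule integral_cong) (auto simp: m_def min_def max_def power2_eq_square algebra_simps)
    also have "\<dots> = \<delta> * I - J"
      unfolding I_def J_def
      by (subst integral_diff)
        (auto intro!: integrable_continuous_interval continuous_intros G m2)
    finally show ?thesis .
  qed
  define \<delta> where "\<delta> = J / 2 / (\<bar>I\<bar> + 1)"
  have "0 < \<delta>" using J by (simp add: \<delta>_def)
  have "\<delta> * I \<le> \<delta> * (\<bar>I\<bar> + 1)" using \<open>0 < \<delta>\<close> by (intro mult_left_mono) auto
  also have "\<dots> = J / 2"
    unfolding \<delta>_def by (rule nonzero_eq_divide_eq[THEN iffD1]) auto
  finally show False using ineq[OF \<open>0 < \<delta>\<close>] J by simp
qed

section \<open>The inequality for the weight\<close>

theorem lemma9:
  fixes \<aa> :: "real \<Rightarrow> real \<Rightarrow> real"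
  assumes cont: "continuous_on ({-1..1} \<times> {0..}) (\<lambda>(x, v). \<aa> x v)"
    and nonneg: "\<forall>x\<in>{-1..1}. \<forall>v\<ge>0. \<aa> x v \<ge> 0"
    and ineq: "\<forall>F\<in>\<FF>. \<forall>u. piecewise_linear_on (-1) 1 u \<and> (\<forall>x\<in>{-1..1}. u x \<ge> 0) \<and>
                  u (-1) = 0 \<and> u 1 = 0 \<longrightarrow>
                  weighted_functional F \<aa> (symm_rearr u) \<le> weighted_functional F \<aa> u"
  shows "\<forall>s\<in>{-1..1}. \<forall>t\<in>{-1..1}. \<forall>v\<ge>0.
           \<aa> s v + \<aa> t v \<ge> \<aa> ((s - t) / 2) v + \<aa> ((t - s) / 2) v"
proof -
  have interior: "\<aa> ((s - t) / 2) v + \<aa> ((t - s) / 2) v \<le> \<aa> s v + \<aa> t v"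
    if st: "-1 < s" "s < t" "t < 1" and v: "0 < v" for s t v
  proof -
    define r where "r = (t - s) / 2"
    have "0 < r" "r < 1" using st by (simp_all add: r_def)
    then have r: "-1 < -r" "-r < r" "r < 1" by simp_all
    define A where "A = (\<lambda>s t w. \<aa> (left_leg s v w) w + \<aa> (right_leg t v w) w)"
    have A: "continuous_on {0..v} (A s t)" if "-1 < s" "s < t" "t < 1" for s t
      unfolding A_def using that v
      by (intro continuous_on_add continuous_on_weight_left_leg[OF cont]
          continuous_on_weight_right_leg[OF cont]) simp_all
    have "0 \<le> A s t v - A (-r) r v"
    proof (rule continuous_nonneg_if_weighted_integrals_nonneg[OF v, of "\<lambda>w. A s t w - A (-r) r w"])
      show "continuous_on {0..v} (\<lambda>w. A s t w - A (-r) r w)"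
        by (intro continuous_intros A st r)
    next
      fix \<phi> :: "real \<Rightarrow> real"
      assume \<phi>: "continuous_on {0..} \<phi>" and pos: "\<And>w. 0 \<le> w \<Longrightarrow> 0 < \<phi> w"
      have nn: "\<And>w. 0 \<le> w \<Longrightarrow> 0 \<le> \<phi> w" using pos by (simp add: less_imp_le)
      have "(\<lambda>w p. \<phi> w * p) \<in> \<FF>"
        unfolding integrand_class_def
      proof (intro CollectI conjI allI impI)
        show "continuous_on ({0..} \<times> {0..}) (\<lambda>(w, p). \<phi> w * p)"
          unfolding case_prod_beta
          by (intro continuous_intros continuous_on_compose2[OF \<phi>]) auto
        fix w :: real assume w: "0 \<le> w"
        show "0 \<le> \<phi> w * p" if "0 \<le> p" for p using nn[OF w] that by simp
        show "convex_on {0..} ((*) (\<phi> w))"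
          by (rule convex_onI) (auto simp: algebra_simps)
        show "strict_mono_on {0..} ((*) (\<phi> w))"
          using pos[OF w] by (auto simp: strict_mono_on_def)
      qed
      then have "weighted_functional (\<lambda>w p. \<phi> w * p) \<aa> (symm_rearr (trapezoid s t v))
          \<le> weighted_functional (\<lambda>w p. \<phi> w * p) \<aa> (trapezoid s t v)"
        using ineq st v piecewise_linear_on_trapezoid[OF st v] trapezoid_nonneg[of s t v]
        by (auto simp: trapezoid_left trapezoid_right)
      moreover have "weighted_functional (\<lambda>w p. \<phi> w * p) \<aa> (trapezoid s t v)
          = ennreal (integral {0..v} (\<lambda>w. \<phi> w * A s t w))"
        unfolding A_def by (rule weighted_functional_trapezoid[OF st v \<phi> nn cont nonneg]) auto
      moreover have "weighted_functional (\<lambda>w p. \<phi> w * p) \<aa> (symm_rearr (trapezoid s t v))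
          = ennreal (integral {0..v} (\<lambda>w. \<phi> w * A (-r) r w))"
        unfolding A_def
        by (rule weighted_functional_trapezoid[OF r v \<phi> nn cont nonneg])
          (simp_all add: symm_rearr_trapezoid[OF st v] r_def)
      moreover have "continuous_on {0..v} \<phi>" using \<phi> by (rule continuous_on_subset) auto
      then have int: "(\<lambda>w. \<phi> w * A s t w) integrable_on {0..v}"
        "(\<lambda>w. \<phi> w * A (-r) r w) integrable_on {0..v}"
        by (auto intro!: integrable_continuous_interval continuous_on_mult A st r)
      moreover have "0 \<le> integral {0..v} (\<lambda>w. \<phi> w * A s t w)"
      proof (rule integral_nonneg[OF int(1)])
        fix w assume w: "w \<in> {0..v}"
        have "left_leg s v w \<in> {-1..1}" "right_leg t v w \<in> {-1..1}"
          using left_leg_mem[of s v w] right_leg_mem[of t v w] w st v by simp_all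
        then show "0 \<le> \<phi> w * A s t w"
          unfolding A_def using w nn[of w] nonneg by (intro mult_nonneg_nonneg add_nonneg_nonneg) auto
      qed
      ultimately have "integral {0..v} (\<lambda>w. \<phi> w * A (-r) r w) \<le> integral {0..v} (\<lambda>w. \<phi> w * A s t w)"
        by simp
      then show "0 \<le> integral {0..v} (\<lambda>w. \<phi> w * (A s t w - A (-r) r w))"
        using int by (simp add: right_diff_distrib integral_diff)
    qed (use v in auto)
    then have "A (-r) r v \<le> A s t v" by simp
    moreover have top: "A s t v = \<aa> s v + \<aa> t v" for s t
      using v by (simp add: A_def left_leg_def right_leg_def)
    ultimately have "\<aa> (-r) v + \<aa> r v \<le> \<aa> s v + \<aa> t v"
      unfolding top by simp
    moreover have minus_r: "-r = (s - t) / 2"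
      by (simp only: r_def minus_divide_left minus_diff_eq)
    ultimately show ?thesis
      unfolding minus_r unfolding r_def by simp
  qed
  \<comment> \<open>Shrinking \<open>s\<close> and \<open>t\<close> by the factor \<open>1 - e\<close> makes room in \<open>[-1, 1]\<close> to push them apart by
     \<open>e / 2\<close> each, so that the perturbed points are distinct and interior even if \<open>s = t\<close> or if
     they are end points, and the level \<open>v + e\<close> is positive. Then \<open>e\<close> tends to \<open>0\<close>.\<close>
  have ordered: "\<aa> ((s - t) / 2) v + \<aa> ((t - s) / 2) v \<le> \<aa> s v + \<aa> t v"
    if st: "-1 \<le> s" "s \<le> t" "t \<le> 1" and v: "0 \<le> v" for s t v
  proof -
    define S where "S = (\<lambda>e. (1 - e) * s - e / 2)"
    define T where "T = (\<lambda>e. (1 - e) * t + e / 2)"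
    define D where "D = (\<lambda>e. \<aa> (S e) (v + e) + \<aa> (T e) (v + e)
      - (\<aa> ((S e - T e) / 2) (v + e) + \<aa> ((T e - S e) / 2) (v + e)))"
    have bounds: "-(1 - e) \<le> (1 - e) * s \<and> (1 - e) * s \<le> (1 - e) * t \<and> (1 - e) * t \<le> 1 - e"
      if "e \<in> {0..1}" for e
      using that st mult_left_mono[of "-1" s "1 - e"] mult_left_mono[of t 1 "1 - e"]
      by (auto intro: mult_left_mono)
    have "continuous_on {0..1} S" "continuous_on {0..1} T"
      unfolding S_def T_def by (intro continuous_intros; simp)+
    moreover have "S e \<in> {-1..1} \<and> T e \<in> {-1..1} \<and> (S e - T e) / 2 \<in> {-1..1}
        \<and> (T e - S e) / 2 \<in> {-1..1}" if "e \<in> {0..1}" for e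
      using bounds[OF that] that by (auto simp: S_def T_def)
    ultimately have "continuous_on {0..1} D"
      unfolding D_def using v
      by (intro continuous_on_add continuous_on_diff continuous_on_weight_compose[OF cont])
        (auto intro!: continuous_intros simp: image_subset_iff)
    moreover have "0 \<le> D e" if "e \<in> {0<..<1}" for e
    proof -
      have e: "0 < e" "e < 1" "e \<in> {0..1}" using that by auto
      have "-1 < S e" "S e < T e" "T e < 1" "0 < v + e"
        unfolding S_def T_def using bounds[OF e(3)] e(1,2) v by linarith+
      from interior[OF this] show ?thesis by (simp add: D_def)
    qed
    ultimately have "0 \<le> D 0"
      by - (rule continuous_ge_on_closure[of "{0<..<1::real}" D]; auto)
    then show ?thesis by (simp add: D_def S_def T_def)
  qed
  show ?thesis
  proof (intro ballI allI impI)
    fix s t v :: real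
    assume "s \<in> {-1..1}" "t \<in> {-1..1}" "0 \<le> v"
    then show "\<aa> ((s - t) / 2) v + \<aa> ((t - s) / 2) v \<le> \<aa> s v + \<aa> t v"
      using ordered[of s t v] ordered[of t s v] by (cases "s \<le> t") auto
  qed
qed

end
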